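(* Let $1<c<11/6$, and let $0<\varepsilon<10^{-10}$ be a sufficiently small constant. Suppose that $\mathscr{A}\subseteq\mathbb{N}$ satisfies conditions (C1) and (C2) below. Then, as $x\to\infty$, \[ \#\{\,n\leqslant x:\ n\in\mathscr{A},\ [n^c]\ \text{is cube-free}\,\}=\frac{1}{\zeta(3)}\,\mathscr{A}(x)+O\big(x^{1-\varepsilon}\big), \] where $\mathscr{A}(x)=\#\{n\leqslant x: n\in\mathscr{A}\}$ and the implied constant may depend on $c$, $\varepsilon$ and $\mathscr{A}$. (C1) For every $\eta>0$ one has $\mathscr{A}(x)\gg_\eta x^{1-\eta}$ for all sufficiently large $x$. (C2) For every sufficiently small $\eta>0$ there exist a constant $\delta$, depending only on $c$ (and $\eta$), with $\eta\leqslant\delta<1/2$, and a constant $C>0$, such that for all real $x>1$ and all integers $a,q$ with $(a,q)=1$ and $2\leqslant q\leqslant x^{\eta}$, setting $\alpha=a/q$, \[ \Big|\sum_{\substack{n\leqslant x\\ n\in\mathscr{A}}} e\big(\alpha[n^c]\big)\Big|\leqslant C\,x^{1-\delta}. \]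
   Context: $[t]$ denotes the integer part of $t$; $e(t)=e^{2\pi i t}$; $\zeta$ is the Riemann zeta function. A positive integer is cube-free if it is not divisible by $m^3$ for any integer $m\geqslant 2$. *)

theory Defs
  imports Complex_Main "HOL-Library.Landau_Symbols"
begin

definition e :: "real \<Rightarrow> complex" where
  "e t = exp (2 * of_real pi * \<i> * of_real t)"

definition cube_free :: "nat \<Rightarrow> bool" where
  "cube_free m \<longleftrightarrow> m > 0 \<and> (\<forall>k::nat. k \<ge> 2 \<longrightarrow> \<not> k ^ 3 dvd m)"

definition zeta3 :: real where
  "zeta3 = (\<Sum>n. 1 / (real (Suc n)) ^ 3)"

definition count_A :: "nat set \<Rightarrow> real \<Rightarrow> nat" where
  "count_A A x = card {n \<in> A. 1 \<le> n \<and> real n \<le> x}"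

definition cond_C1 :: "nat set \<Rightarrow> bool" where
  "cond_C1 A \<longleftrightarrow> (\<forall>\<eta>>0. \<exists>K>0. eventually (\<lambda>x. real (count_A A x) \<ge> K * x powr (1 - \<eta>)) at_top)"

definition cond_C2 :: "real \<Rightarrow> nat set \<Rightarrow> bool" where
  "cond_C2 c A \<longleftrightarrow> (\<exists>\<eta>0>0. \<forall>\<eta>. 0 < \<eta> \<and> \<eta> < \<eta>0 \<longrightarrow>
     (\<exists>\<delta> C. \<eta> \<le> \<delta> \<and> \<delta> < 1/2 \<and> C > 0 \<and>
       (\<forall>x::real. \<forall>a q::int. x > 1 \<and> coprime a q \<and> 2 \<le> q \<and> real_of_int q \<le> x powr \<eta> \<longrightarrow>
          norm (\<Sum>n\<in>{n \<in> A. 1 \<le> n \<and> real n \<le> x}.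
                   e (real_of_int a / real_of_int q * real_of_int \<lfloor>real n powr c\<rfloor>))
            \<le> C * x powr (1 - \<delta>))))"

end

theory Submission
  imports Defs "HOL-Analysis.Infinite_Sum" "HOL-Analysis.Complex_Transcendental"
    "HOL-Computational_Algebra.Squarefree"
begin

text \<open>
  Write \<open>[n\<^sup>c cube-free]\<close> as the sum of \<open>\<mu>(d)\<close> over all \<open>d\<close> with \<open>d\<^sup>3\<close> dividing the integer part of
  \<open>n\<^sup>c\<close>. For \<open>d \<le> x powr (\<eta>/3)\<close> additive characters modulo \<open>d\<^sup>3\<close> and (C2) show that a proportion
  \<open>1/d\<^sup>3\<close> of the elements of \<open>A\<close> is hit, and these \<open>d\<close> produce the main term. For larger \<open>d\<close> one only
  needs an upper bound for the number of hits among all \<open>n \<le> x\<close>, and this is elementary. Hits give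
  distinct multiples of \<open>d\<^sup>3\<close>, so there are at most \<open>x\<^sup>c/d\<^sup>3\<close> of them, which suffices for
  \<open>d > x powr ((c-1)/2 + \<kappa>)\<close>. In between, fix \<open>B\<close> of size \<open>d x\<^sup>\<kappa>\<close>: all but \<open>x/B + 1\<close> hits
  \<open>n\<close> have another hit \<open>n + a\<close> with \<open>a \<le> B\<close>. Then \<open>(n+a)\<^sup>c - n\<^sup>c\<close> is within \<open>1\<close> of a multiple
  of \<open>d\<^sup>3\<close>, while consecutive values of this function of \<open>n\<close> differ by at least
  \<open>c(c-1) a x powr (c-2)\<close>, so that few \<open>n\<close> qualify.
\<close>

subsection \<open>The Moebius function and cube-free integers\<close>

definition mu :: "nat \<Rightarrow> real" where
  "mu n = (if squarefree n then (-1) ^ card (prime_factors n) else 0)"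

lemma abs_mu_le_1: "\<bar>mu n\<bar> \<le> 1"
  by (simp add: mu_def)

lemma mu_prime_mult:
  assumes "prime p" "\<not> p dvd d"
  shows "mu (p * d) = - mu d"
proof -
  from assms have d: "d \<noteq> 0" by (metis dvd_0_right)
  have cop: "coprime p d" using assms by (simp add: prime_imp_coprime)
  have sq: "squarefree (p * d) \<longleftrightarrow> squarefree d"
    using squarefree_mult_coprime[OF cop] squarefree_prime[OF assms(1)] squarefree_multD by blast
  have "prime_factors (p * d) = insert p (prime_factors d)"
    using assms d by (simp add: prime_factors_product prime_prime_factors)
  moreover have "p \<notin> prime_factors d" using assms by auto
  ultimately show ?thesis by (simp add: mu_def sq)
qed

text \<open>Fix a prime \<open>p\<close> dividing \<open>n\<close>. The divisors \<open>d\<close>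
  prime to \<open>p\<close> pair with \<open>p * d\<close>, which has the opposite sign, and
  divisors containing \<open>p ^ 2\<close> contribute nothing.\<close>

lemma sum_mu_dvd:
  assumes "n > 0"
  shows "(\<Sum>d | d dvd n. mu d) = (if n = 1 then 1 else 0)"
proof (cases "n = 1")
  case False
  then obtain p where p: "prime p" "p dvd n" using prime_factor_nat by blast
  have fin: "finite {d. d dvd n}" using assms by simp
  let ?U = "{d. d dvd n \<and> \<not> p dvd d}" and ?V = "{d. d dvd n \<and> p dvd d}"
  let ?W = "{d. d dvd n \<and> p dvd d \<and> \<not> p ^ 2 dvd d}"
  have bij: "bij_betw (\<lambda>d. p * d) ?U ?W"
  proof (rule bij_betwI[where g = "\<lambda>d. d div p"])
    show "(\<lambda>d. p * d) \<in> ?U \<rightarrow> ?W"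
    proof
      fix d assume d: "d \<in> ?U"
      then have "coprime p d" using p by (simp add: prime_imp_coprime)
      then have "p * d dvd n" using d p by (simp add: divides_mult)
      moreover have "\<not> p ^ 2 dvd p * d" using d p by (auto simp: power2_eq_square)
      ultimately show "p * d \<in> ?W" by auto
    qed
    show "(\<lambda>d. d div p) \<in> ?W \<rightarrow> ?U"
    proof
      fix d assume d: "d \<in> ?W"
      then obtain k where k: "d = p * k" by auto
      then show "d div p \<in> ?U"
        using d p by (auto simp: power2_eq_square intro: dvd_mult_right)
    qed
  qed (use p in auto)
  \<comment> \<open>The elements of \<open>?V\<close> outside \<open>?W\<close> are divisible by
    \<open>p ^ 2\<close>, hence not squarefree.\<close>
  have "(\<Sum>d\<in>?V. mu d) = (\<Sum>d\<in>?W. mu d)"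
  proof (rule sum.mono_neutral_right)
    show "\<forall>d\<in>?V - ?W. mu d = 0"
      using p by (auto simp: mu_def dest!: squarefreeD)
  qed (use fin in auto)
  also have "\<dots> = (\<Sum>d\<in>?U. mu (p * d))"
    by (rule sum.reindex_bij_betw[OF bij, symmetric])
  also have "\<dots> = - (\<Sum>d\<in>?U. mu d)"
    unfolding sum_negf[symmetric] by (rule sum.cong) (use p mu_prime_mult in auto)
  finally have "(\<Sum>d\<in>?U. mu d) + (\<Sum>d\<in>?V. mu d) = 0" by simp
  moreover have "(\<Sum>d | d dvd n. mu d) = (\<Sum>d\<in>?U. mu d) + (\<Sum>d\<in>?V. mu d)"
    by (subst sum.union_disjoint[symmetric]) (use fin in \<open>auto intro!: sum.cong\<close>)
  ultimately show ?thesis using False by simp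
qed (simp add: mu_def)

section \<open>Cubes dividing a given integer\<close>

lemma finite_cube_dvd:
  assumes "m > (0::nat)"
  shows "finite {d. d ^ 3 dvd m}"
proof (rule finite_subset)
  show "{d. d ^ 3 dvd m} \<subseteq> {..m}"
  proof safe
    fix d assume d: "d ^ 3 dvd m"
    have "d dvd d ^ 3" by simp
    then have "d dvd m" using d dvd_trans by blast
    then show "d \<le> m" using assms by (rule dvd_imp_le)
  qed
qed simp

text \<open>The set of \<open>d\<close> with \<open>d ^ 3 dvd m\<close> is closed under
  \<open>lcm\<close>, so its largest element is a multiple of all the others. This turns a sum over
  cube divisors into a sum over the divisors of one integer \<open>k\<close>.\<close>

lemma cube_root_part:
  assumes "m > (0::nat)"
  obtains k where "k > 0" "\<And>d. d ^ 3 dvd m \<longleftrightarrow> d dvd k"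
proof -
  let ?S = "{d. d ^ 3 dvd m}"
  define k where "k = Max ?S"
  have one: "1 \<in> ?S" by simp
  have k: "k \<in> ?S" unfolding k_def using finite_cube_dvd[OF assms] one by (intro Max_in) blast+
  have kmax: "d \<le> k" if "d \<in> ?S" for d
    unfolding k_def using finite_cube_dvd[OF assms] that by simp
  have k0: "k > 0" using kmax[OF one] by simp
  have "d dvd k" if d: "d ^ 3 dvd m" for d
  proof -
    have d0: "d > 0" using d assms by (cases d) auto
    have "lcm d k ^ 3 dvd m"
    proof -
      \<comment> \<open>Take out the gcd \<open>g\<close>, so that the lcm is
        \<open>u * v * g\<close>. Both \<open>u ^ 3\<close> and \<open>v ^ 3\<close> divide the
        cofactor \<open>w\<close> of \<open>g ^ 3\<close> in \<open>m\<close>, and as they are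
        coprime so does their product.\<close>
      obtain u v where uv: "d = u * gcd d k" "k = v * gcd d k" "coprime u v"
        using gcd_coprime_exists[of d k] d0 by auto
      have g: "gcd d k > 0" using d0 by simp
      have "u * v * gcd d k * gcd d k = d * k" using uv by (metis mult.assoc mult.commute)
      also have "\<dots> = lcm d k * gcd d k" by (metis mult.commute prod_gcd_lcm_nat)
      finally have l: "lcm d k = u * v * gcd d k" using g by (metis mult_cancel2 less_numeral_extra(3))
      have "gcd d k ^ 3 dvd m" using d by (meson dvd_power_same dvd_trans gcd_dvd1)
      then obtain w where w: "m = gcd d k ^ 3 * w" by auto
      have "u ^ 3 * gcd d k ^ 3 dvd m" using d uv(1) by (metis power_mult_distrib)
      then have "u ^ 3 dvd w" using w g d0 by (simp add: mult.commute)
      moreover have "v ^ 3 * gcd d k ^ 3 dvd m" using k uv(2) by (metis mem_Collect_eq power_mult_distrib)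
      then have "v ^ 3 dvd w" using w g d0 by (simp add: mult.commute)
      ultimately have "u ^ 3 * v ^ 3 dvd w" using uv(3) by (simp add: divides_mult)
      then show ?thesis unfolding l w by (simp add: power_mult_distrib mult.commute)
    qed
    then have "lcm d k \<le> k" using kmax by simp
    then have "lcm d k = k" by (metis dvd_lcm2 dvd_imp_le k0 le_antisym lcm_pos_nat d0)
    then show ?thesis by (metis dvd_lcm1)
  qed
  moreover have "d ^ 3 dvd m" if "d dvd k" for d
    using that k by (meson dvd_power_same dvd_trans mem_Collect_eq)
  ultimately show ?thesis using that k0 by blast
qed

text \<open>With \<open>k\<close> from \<open>cube_root_part\<close>, this is the divisor sum of
  \<open>mu\<close> over \<open>k\<close>, and \<open>m\<close> is cube-free exactly when
  \<open>k = 1\<close>.\<close>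

lemma sum_mu_cube_dvd:
  assumes "m > 0"
  shows "(\<Sum>d | d ^ 3 dvd m. mu d) = (if cube_free m then 1 else 0)"
proof -
  obtain k where k: "k > 0" "\<And>d. d ^ 3 dvd m \<longleftrightarrow> d dvd k" using cube_root_part[OF assms] by blast
  have "cube_free m \<longleftrightarrow> k = 1"
  proof
    assume "cube_free m"
    then have "\<not> k \<ge> 2" using k(2)[of k] by (auto simp: cube_free_def)
    then show "k = 1" using k(1) by simp
  qed (use assms k in \<open>auto simp: cube_free_def\<close>)
  then show ?thesis using sum_mu_dvd[OF k(1)] by (simp add: k(2))
qed

section \<open>The reciprocal of zeta(3) as a Moebius series\<close>

lemma has_sum_zeta3: "((\<lambda>n. 1 / real n ^ 3) has_sum zeta3) {1..}"
proof -
  have "summable (\<lambda>n. inverse (real (Suc n) ^ 3))"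
    by (subst summable_Suc_iff) (rule inverse_power_summable, simp)
  then have s: "summable (\<lambda>n. 1 / real (Suc n) ^ 3)" by (simp add: field_simps)
  then have "((\<lambda>n. 1 / real (Suc n) ^ 3) has_sum zeta3) UNIV"
    unfolding zeta3_def by (intro norm_summable_imp_has_sum summable_sums) simp_all
  then show ?thesis
    by (subst has_sum_reindex_bij_witness[where j = "\<lambda>n. n - 1" and i = Suc and T = UNIV
          and h = "\<lambda>n. 1 / real (Suc n) ^ 3" and s' = zeta3]) auto
qed

lemma zeta3_pos: "zeta3 > 0"
proof -
  have "((\<lambda>n. 1 / real n ^ 3) has_sum 1) {1::nat}" by (rule has_sum_finiteI) auto
  then have "1 \<le> zeta3" by (rule has_sum_mono'[OF _ has_sum_zeta3]) auto
  then show ?thesis by simp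
qed

lemma mu_cube_abs_summable: "(\<lambda>d. mu d / real d ^ 3) abs_summable_on {1..}"
proof (rule summable_on_comparison_test)
  show "(\<lambda>n. 1 / real n ^ 3) summable_on {1..}" using has_sum_zeta3 by (rule has_sum_imp_summable)
  show "norm (mu d / real d ^ 3) \<le> 1 / real d ^ 3" for d
    using abs_mu_le_1[of d] by (auto intro!: divide_right_mono)
qed auto

text \<open>Let \<open>M\<close> be the value of the series. Then \<open>M * zeta3\<close> is an
  absolutely convergent double sum over \<open>(d, k)\<close>. Grouping its terms by
  \<open>n = d * k\<close> produces the divisor sums of \<open>mu\<close>, which vanish except at
  \<open>n = 1\<close>, so \<open>M * zeta3 = 1\<close>.\<close>

lemma has_sum_mu_cube: "((\<lambda>d. mu d / real d ^ 3) has_sum 1 / zeta3) {1..}"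
proof -
  define M where "M = infsum (\<lambda>d. mu d / real d ^ 3) {1..}"
  have M: "((\<lambda>d. mu d / real d ^ 3) has_sum M) {1..}"
    unfolding M_def by (rule has_sum_infsum[OF abs_summable_summable[OF mu_cube_abs_summable]])
  let ?f = "\<lambda>(d, k). mu d / real d ^ 3 * (1 / real k ^ 3)"
  have inner: "((\<lambda>k. ?f (d, k)) has_sum mu d / real d ^ 3 * zeta3) {1..}" for d
    using has_sum_cmult_right[OF has_sum_zeta3, of "mu d / real d ^ 3"] by simp
  have outer: "((\<lambda>d. mu d / real d ^ 3 * zeta3) has_sum M * zeta3) {1..}"
    by (rule has_sum_cmult_left[OF M])
  have "?f abs_summable_on {1..} \<times> {1..}"
  proof (subst abs_summable_on_Sigma_iff, intro conjI ballI)
    fix d :: nat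
    have "(\<lambda>k. \<bar>mu d\<bar> / real d ^ 3 * (1 / real k ^ 3)) summable_on {1..}"
      using has_sum_cmult_right[OF has_sum_zeta3] by (rule has_sum_imp_summable)
    then show "(\<lambda>k. ?f (d, k)) abs_summable_on {1..}"
      by (simp add: abs_mult)
  next
    have "(\<Sum>\<^sub>\<infinity>k\<in>{1..}. norm (?f (d, k))) = norm (mu d / real d ^ 3) * zeta3" for d
      using has_sum_cmult_right[OF has_sum_zeta3, of "norm (mu d / real d ^ 3)"]
      by (intro infsumI) (simp add: abs_mult)
    then show "(\<lambda>d. \<Sum>\<^sub>\<infinity>k\<in>{1..}. norm (?f (d, k))) abs_summable_on {1..}"
      using summable_on_cmult_left[OF mu_cube_abs_summable, of zeta3] zeta3_pos
      by (simp add: abs_mult)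
  qed
  then have "(?f has_sum M * zeta3) ({1..} \<times> {1..})"
    by (rule has_sum_SigmaI[OF inner outer abs_summable_summable])
  also have "(?f has_sum M * zeta3) ({1..} \<times> {1..}) \<longleftrightarrow>
      ((\<lambda>(n, d). mu d / real n ^ 3) has_sum M * zeta3) (SIGMA n:{1..}. {d. d dvd n})"
  \<comment> \<open>Pairs \<open>(d, k)\<close> of positive integers correspond to pairs
    \<open>(n, d)\<close> with \<open>d dvd n\<close>, through \<open>n = d * k\<close>.\<close>
  proof (rule has_sum_reindex_bij_witness[where j = "\<lambda>(d, k). (d * k, d)" and i = "\<lambda>(n, d). (d, n div d)"])
    fix b assume "b \<in> (SIGMA n:{1::nat..}. {d. d dvd n})"
    then obtain d k where "b = (d * k, d)" "d > 0" "k > 0" by (auto elim!: dvdE)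
    then show "(case case b of (n, d) \<Rightarrow> (d, n div d) of (d, k) \<Rightarrow> (d * k, d)) = b"
      and "(case b of (n, d) \<Rightarrow> (d, n div d)) \<in> {1..} \<times> {1..}" by auto
  qed (auto simp: power_mult_distrib)
  finally have "((\<lambda>n. (if n = 1 then 1 else 0) / real n ^ 3) has_sum M * zeta3) {1..}"
  proof (rule has_sum_SigmaD)
    fix n :: nat assume n: "n \<in> {1..}"
    have "(\<Sum>d | d dvd n. mu d / real n ^ 3) = (if n = 1 then 1 else 0) / real n ^ 3"
      using n by (subst sum_divide_distrib[symmetric], subst sum_mu_dvd) auto
    then show "((\<lambda>d. case (n, d) of (n, d) \<Rightarrow> mu d / real n ^ 3) has_sum
        (if n = 1 then 1 else 0) / real n ^ 3) {d. d dvd n}"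
      using n by (intro has_sum_finiteI) auto
  qed
  moreover have "((\<lambda>n::nat. (if n = 1 then 1 else 0) / real n ^ 3) has_sum 1) {1..}"
  proof -
    have "((\<lambda>n::nat. (if n = 1 then 1 else 0) / real n ^ 3) has_sum 1) {1}"
      by (rule has_sum_finiteI) auto
    then show ?thesis
      by (rule has_sum_cong_neutral[THEN iffD1, rotated -1]) auto
  qed
  ultimately have "M * zeta3 = 1" using has_sum_unique by blast
  then have "M = 1 / zeta3" using zeta3_pos by (simp add: field_simps)
  then show ?thesis using M by simp
qed

text \<open>Telescoping, from 1/(n+1)^2 \<le> 1/n - 1/(n+1).\<close>

lemma sum_inverse_squares_tail:
  assumes "M \<ge> 1"
  shows "(\<Sum>d\<in>{M<..N}. 1 / real d ^ 2) \<le> 1 / real M"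
proof (cases "M \<le> N")
  case True
  then have "(\<Sum>d\<in>{M<..N}. 1 / real d ^ 2) \<le> 1 / real M - 1 / real N"
  proof (induction N rule: dec_induct)
    case (step N)
    have "{M<..Suc N} = insert (Suc N) {M<..N}" using step by auto
    moreover have "1 / real (Suc N) ^ 2 \<le> 1 / real N - 1 / real (Suc N)"
      using step(1) assms
      by (simp add: divide_simps power2_eq_square del: of_nat_Suc) (simp add: algebra_simps)
    ultimately show ?case using step by simp
  qed simp
  then show ?thesis by (smt (verit) divide_nonneg_nonneg of_nat_0_le_iff)
qed simp

lemma sum_inverse_cubes_tail:
  assumes "M \<ge> 1"
  shows "(\<Sum>d\<in>{M<..N}. 1 / real d ^ 3) \<le> 1 / real M ^ 2"
proof -
  have "(\<Sum>d\<in>{M<..N}. 1 / real d ^ 3) \<le> (\<Sum>d\<in>{M<..N}. 1 / real M * (1 / real d ^ 2))"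
  proof (rule sum_mono)
    fix d assume "d \<in> {M<..N}"
    then have "real M * real d ^ 2 \<le> real d ^ 3" "0 < real M * real d ^ 2"
      using assms by (auto simp: power3_eq_cube power2_eq_square intro!: mult_right_mono)
    then show "1 / real d ^ 3 \<le> 1 / real M * (1 / real d ^ 2)" by (simp add: frac_le)
  qed
  also have "\<dots> = 1 / real M * (\<Sum>d\<in>{M<..N}. 1 / real d ^ 2)" by (rule sum_distrib_left[symmetric])
  also have "\<dots> \<le> 1 / real M * (1 / real M)"
    by (intro mult_left_mono sum_inverse_squares_tail assms) simp
  finally show ?thesis by (simp add: power2_eq_square)
qed

text \<open>The partial sums up to \<open>M\<close> and up to any \<open>N \<ge> M\<close> differ by
  at most the tail of the inverse cubes; this bound is uniform in \<open>N\<close> and survives the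
  limit.\<close>

lemma mu_cube_partial_sum:
  assumes "M \<ge> 1"
  shows "\<bar>(\<Sum>d\<in>{1..M}. mu d / real d ^ 3) - 1 / zeta3\<bar> \<le> 1 / real M ^ 2"
proof -
  have "((\<lambda>n. mu (Suc n) / real (Suc n) ^ 3) has_sum 1 / zeta3) UNIV"
    by (subst has_sum_reindex_bij_witness[where i = "\<lambda>n. n - 1" and j = Suc and T = "{1..}"
          and h = "\<lambda>n. mu n / real n ^ 3" and s' = "1 / zeta3"]) (use has_sum_mu_cube in auto)
  then have "(\<lambda>n. mu (Suc n) / real (Suc n) ^ 3) sums (1 / zeta3)" by (rule has_sum_imp_sums)
  then have "(\<lambda>N. \<Sum>n<N. mu (Suc n) / real (Suc n) ^ 3) \<longlonglongrightarrow> 1 / zeta3" by (simp add: sums_def)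
  moreover have "(\<Sum>n<N. mu (Suc n) / real (Suc n) ^ 3) = (\<Sum>d\<in>{1..N}. mu d / real d ^ 3)" for N
    by (rule sum.reindex_bij_witness[where i = "\<lambda>n. n - 1" and j = Suc]) auto
  ultimately have lim: "(\<lambda>N. \<Sum>d\<in>{1..N}. mu d / real d ^ 3) \<longlonglongrightarrow> 1 / zeta3" by simp
  have "\<bar>(\<Sum>d\<in>{1..M}. mu d / real d ^ 3) - (\<Sum>d\<in>{1..N}. mu d / real d ^ 3)\<bar> \<le> 1 / real M ^ 2"
    if "N \<ge> M" for N
  proof -
    have "(\<Sum>d\<in>{1..N}. mu d / real d ^ 3) = (\<Sum>d\<in>{1..M}. mu d / real d ^ 3) + (\<Sum>d\<in>{M<..N}. mu d / real d ^ 3)"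
      using that assms by (subst sum.union_disjoint[symmetric]) (auto intro!: sum.cong)
    moreover have "\<bar>\<Sum>d\<in>{M<..N}. mu d / real d ^ 3\<bar> \<le> (\<Sum>d\<in>{M<..N}. 1 / real d ^ 3)"
      by (rule order_trans[OF sum_abs])
         (use abs_mu_le_1 in \<open>auto intro!: sum_mono divide_right_mono\<close>)
    ultimately show ?thesis using sum_inverse_cubes_tail[OF assms, of N] by simp
  qed
  then have "\<forall>\<^sub>F N in sequentially.
      \<bar>(\<Sum>d\<in>{1..M}. mu d / real d ^ 3) - (\<Sum>d\<in>{1..N}. mu d / real d ^ 3)\<bar> \<le> 1 / real M ^ 2"
    using eventually_sequentially by blast
  then show ?thesis
    by (intro tendsto_upperbound[OF tendsto_rabs[OF tendsto_diff[OF tendsto_const lim]]]) auto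
qed

section \<open>Orthogonality of additive characters modulo q\<close>

lemma sum_e_div:
  fixes m :: int
  assumes "q > 0"
  shows "(\<Sum>h<q. e (real h / real q * real_of_int m)) = (if int q dvd m then of_nat q else 0)"
proof -
  \<comment> \<open>The sum is geometric with ratio \<open>z\<close>, a q-th root of unity that
    equals \<open>1\<close> exactly when \<open>q\<close> divides \<open>m\<close>.\<close>
  define z where "z = e (real_of_int m / real q)"
  have pow: "e (real h / real q * real_of_int m) = z ^ h" for h
    unfolding z_def e_def exp_of_nat_mult[symmetric] by (simp add: mult_ac)
  have zq: "z ^ q = 1"
  proof -
    have "z ^ q = e (real_of_int m)" using pow[of q, symmetric] assms by simp
    also have "\<dots> = 1" unfolding e_def exp_eq_1 by (auto simp: mult_ac)
    finally show ?thesis .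
  qed
  have z1: "z = 1 \<longleftrightarrow> int q dvd m"
  proof -
    have "z = 1 \<longleftrightarrow> (\<exists>n::int. real_of_int m / real q = real_of_int n)"
    proof -
      have "Im (2 * of_real pi * \<i> * of_real (real_of_int m / real q)) = real_of_int (2 * n) * pi
          \<longleftrightarrow> real_of_int m / real q = real_of_int n" for n
        using mult_cancel_left[of "2 * pi" "real_of_int m / real q" "real_of_int n"] by (simp add: mult_ac)
      then show ?thesis unfolding z_def e_def exp_eq_1 by simp
    qed
    also have "\<dots> \<longleftrightarrow> (\<exists>n::int. real_of_int m = real_of_int (int q * n))"
      using assms by (simp add: field_simps)
    also have "\<dots> \<longleftrightarrow> int q dvd m" unfolding of_int_eq_iff dvd_def by simp
    finally show ?thesis .
  qed
  show ?thesis unfolding pow using zq z1 by (simp add: sum_gp_strict)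
qed

subsection \<open>Integers whose power is nearly divisible by a large cube\<close>

text \<open>Split off the set \<open>R\<close> of those \<open>n\<close> with no further element of
  \<open>S\<close> among the next \<open>B\<close> integers. Each block of \<open>B\<close>
  consecutive integers contains at most one such \<open>n\<close>; every other \<open>n\<close> is
  counted by some shift \<open>a\<close>.\<close>

lemma card_le_close_pairs:
  fixes S :: "nat set" and B :: nat
  assumes S: "S \<subseteq> {1..X}" and B: "B \<ge> 1"
  shows "real (card S) \<le> real X / real B + 1 + (\<Sum>a\<in>{1..B}. real (card {n \<in> S. n + a \<in> S}))"
proof -
  have fin: "finite S" using S finite_subset by blast
  define R where "R = {n \<in> S. \<forall>a\<in>{1..B}. n + a \<notin> S}"
  \<comment> \<open>Two numbers with the same quotient by \<open>B\<close> lie less than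
    \<open>B\<close> apart, so the smaller one could not belong to \<open>R\<close>.\<close>
  have neq: "n div B \<noteq> n' div B" if "n \<in> R" "n' \<in> R" "n < n'" for n n'
  proof
    assume eq: "n div B = n' div B"
    have "n' - n < B"
      using mult_div_mod_eq[of B n] mult_div_mod_eq[of B n'] mod_less_divisor[of B n'] B
      unfolding eq by linarith
    then have "n' - n \<in> {1..B}" using that by auto
    moreover have "n + (n' - n) \<in> S" using that by (auto simp: R_def)
    ultimately show False using that(1) unfolding R_def by blast
  qed
  have "inj_on (\<lambda>n. n div B) R"
    by (rule linorder_inj_onI') (use neq in auto)
  moreover have "(\<lambda>n. n div B) ` R \<subseteq> {..X div B}"
    using S by (auto simp: R_def intro!: div_le_mono)
  ultimately have "card R \<le> card {..X div B}" by (metis card_inj_on_le finite_atMost)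
  then have "real (card R) \<le> real (X div B) + 1" by simp
  also have "\<dots> \<le> real X / real B + 1" using of_int_floor_le[of "real X / real B"] by (simp add: floor_divide_of_nat_eq)
  finally have R: "real (card R) \<le> real X / real B + 1" .
  have "S \<subseteq> R \<union> (\<Union>a\<in>{1..B}. {n \<in> S. n + a \<in> S})" by (auto simp: R_def)
  then have "card S \<le> card (R \<union> (\<Union>a\<in>{1..B}. {n \<in> S. n + a \<in> S}))"
    using fin by (intro card_mono) (auto simp: R_def)
  also have "\<dots> \<le> card R + card (\<Union>a\<in>{1..B}. {n \<in> S. n + a \<in> S})" by (rule card_Un_le)
  also have "\<dots> \<le> card R + (\<Sum>a\<in>{1..B}. card {n \<in> S. n + a \<in> S})"
    by (intro add_left_mono card_UN_le) simp
  finally have "real (card S) \<le> real (card R) + (\<Sum>a\<in>{1..B}. real (card {n \<in> S. n + a \<in> S}))"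
    unfolding of_nat_sum[symmetric] of_nat_add[symmetric] of_nat_le_iff .
  with R show ?thesis by simp
qed

text \<open>All values of \<open>f\<close> lie in an interval of length \<open>2\<close>, so the
  least and greatest elements of \<open>T\<close> differ by at most \<open>2 / \<mu>\<close>;
  \<open>T\<close> has no more elements than the integer interval between them.\<close>

lemma card_spaced_le:
  fixes T :: "nat set" and f :: "nat \<Rightarrow> real"
  assumes fin: "finite T" and mu: "\<mu> > 0"
    and spaced: "\<And>m n. m \<in> T \<Longrightarrow> n \<in> T \<Longrightarrow> m < n \<Longrightarrow> \<mu> * (real n - real m) \<le> f n - f m"
    and range: "\<And>n. n \<in> T \<Longrightarrow> \<bar>f n - u\<bar> \<le> 1"
  shows "real (card T) \<le> 2 / \<mu> + 1"
proof (cases "T = {}")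
  case False
  let ?m = "Min T" and ?n = "Max T"
  have in_T: "?m \<in> T" "?n \<in> T" using fin False by auto
  have le: "?m \<le> ?n" using fin in_T by auto
  have "\<mu> * (real ?n - real ?m) \<le> 2"
  proof (cases "?m < ?n")
    case True
    then show ?thesis using spaced[OF in_T True] range[OF in_T(1)] range[OF in_T(2)] by linarith
  next
    case False
    then have "real ?n - real ?m = 0" using le by simp
    then show ?thesis by (metis mult_zero_right zero_le_numeral)
  qed
  then have "real ?n - real ?m \<le> 2 / \<mu>" using mu by (simp add: field_simps)
  moreover have "T \<subseteq> {?m..?n}" using fin by auto
  then have "card T \<le> card {?m..?n}" by (intro card_mono) auto
  then have "real (card T) \<le> real ?n - real ?m + 1" using le by simp
  ultimately show ?thesis by linarith
qed (use mu in simp)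

section \<open>Mean value estimates for powers\<close>

lemma has_real_derivative_powr_shift:
  fixes u a c :: real
  assumes "0 < u + a"
  shows "((\<lambda>u. (u + a) powr c) has_real_derivative c * (u + a) powr (c - 1)) (at u)"
proof -
  have "((\<lambda>u. u + a) has_real_derivative 1) (at u)" by (auto intro!: derivative_eq_intros)
  then show ?thesis
    using DERIV_chain2[where f = "\<lambda>z. z powr c" and g = "\<lambda>u. u + a" and x = u,
        OF has_real_derivative_powr[OF assms]] by fastforce
qed

lemma powr_diff_le:
  fixes s a x c :: real
  assumes "1 < c" "1 \<le> s" "0 < a" "s + a \<le> x"
  shows "(s + a) powr c - s powr c \<le> a * c * x powr (c - 1)"
proof -
  have "\<exists>z. s < z \<and> z < s + a \<and> (s + a) powr c - s powr c = (s + a - s) * (c * z powr (c - 1))"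
    by (rule MVT2) (use assms has_real_derivative_powr in auto)
  then obtain z where z: "s < z" "z < s + a" "(s + a) powr c - s powr c = a * (c * z powr (c - 1))"
    by auto
  have "z powr (c - 1) \<le> x powr (c - 1)" using z assms by (intro powr_mono2) auto
  then show "(s + a) powr c - s powr c \<le> a * c * x powr (c - 1)" unfolding z(3) using assms by simp
qed

text \<open>The mean value theorem is applied twice: to \<open>(u + a) powr c - u powr c\<close>
  between \<open>s\<close> and \<open>t\<close>, then to the power \<open>c - 1\<close> between
  \<open>z\<close> and \<open>z + a\<close>. Since \<open>c < 2\<close>, the power
  \<open>c - 2\<close> is decreasing, so its value at the intermediate point \<open>w\<close> is at
  least that at \<open>x\<close>.\<close>

lemma powr_second_diff_ge:
  fixes s t a x c :: real
  assumes c: "1 < c" "c < 2" and "1 \<le> s" "s < t" "0 < a" "t + a \<le> x"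
  shows "c * (c - 1) * a * x powr (c - 2) * (t - s)
           \<le> ((t + a) powr c - t powr c) - ((s + a) powr c - s powr c)"
proof -
  let ?g = "\<lambda>u. (u + a) powr c - u powr c"
  have "\<exists>z. s < z \<and> z < t \<and> ?g t - ?g s = (t - s) * (c * (z + a) powr (c - 1) - c * z powr (c - 1))"
    by (rule MVT2[OF _ DERIV_diff]) (use assms in \<open>auto intro!: has_real_derivative_powr_shift has_real_derivative_powr\<close>)
  then obtain z where z: "s < z" "z < t"
    "?g t - ?g s = (t - s) * (c * (z + a) powr (c - 1) - c * z powr (c - 1))" by auto
  have "\<exists>w. z < w \<and> w < z + a \<and>
      (z + a) powr (c - 1) - z powr (c - 1) = (z + a - z) * ((c - 1) * w powr (c - 2))"
    by (rule MVT2) (use assms(3,5) z(1) has_real_derivative_powr[of _ "c - 1"] in auto)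
  then obtain w where w: "z < w" "w < z + a"
    "(z + a) powr (c - 1) - z powr (c - 1) = a * ((c - 1) * w powr (c - 2))" by auto
  have wx: "x powr (c - 2) \<le> w powr (c - 2)" using w z assms by (intro powr_mono2') auto
  have "?g t - ?g s = (t - s) * (c * (a * ((c - 1) * w powr (c - 2))))"
    unfolding z(3) w(3)[symmetric] by (simp add: algebra_simps)
  also have "\<dots> = c * (c - 1) * a * (t - s) * w powr (c - 2)" by (simp add: mult_ac)
  also have "\<dots> \<ge> c * (c - 1) * a * (t - s) * x powr (c - 2)"
    by (intro mult_left_mono wx mult_nonneg_nonneg) (use assms in auto)
  finally show ?thesis by (simp add: mult_ac)
qed

text \<open>For \<open>c > 1\<close> the c-th powers of consecutive integers are at least
  \<open>1\<close> apart, so distinct \<open>n\<close> have distinct integer parts and hits can be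
  counted by their values.\<close>

lemma floor_powr_strict_mono:
  assumes c: "1 < c" and "1 \<le> m" "m < n"
  shows "\<lfloor>real m powr c\<rfloor> < \<lfloor>real n powr c\<rfloor>"
proof -
  \<comment> \<open>Both products are arranged so that their first factors can be replaced by the
    larger \<open>(real m + 1) powr (c - 1)\<close>.\<close>
  have "real m powr c + 1 * 1 = real m powr (c - 1) * real m + 1 * 1"
    using powr_add[of "real m" "c - 1" 1] assms by simp
  also have "\<dots> \<le> (real m + 1) powr (c - 1) * real m + (real m + 1) powr (c - 1) * 1"
    by (intro add_mono mult_right_mono powr_mono2 ge_one_powr_ge_zero) (use assms in auto)
  also have "\<dots> = (real m + 1) powr c"
    using powr_add[of "real m + 1" "c - 1" 1] by (simp add: ring_distribs)
  also have "\<dots> \<le> real n powr c" by (rule powr_mono2) (use assms in auto)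
  finally show ?thesis by linarith
qed

section \<open>Upper bounds for the number of hits of a single d\<close>

definition cube_hits :: "real \<Rightarrow> real \<Rightarrow> nat \<Rightarrow> nat set" where
  "cube_hits c x d = {n. 1 \<le> n \<and> real n \<le> x \<and> int d ^ 3 dvd \<lfloor>real n powr c\<rfloor>}"

lemma cube_hits_subset: "cube_hits c x d \<subseteq> {1..nat \<lfloor>x\<rfloor>}"
  by (auto simp: cube_hits_def le_nat_floor)

lemma finite_cube_hits [simp]: "finite (cube_hits c x d)"
  by (rule finite_subset[OF cube_hits_subset]) simp

text \<open>The quotient of the integer part by \<open>d ^ 3\<close> determines \<open>n\<close>,
  and it is a positive integer not exceeding \<open>x powr c / real d ^ 3\<close>.\<close>

lemma card_cube_hits_trivial:
  assumes c: "1 < c" and d: "d \<ge> 1" and x: "x \<ge> 1"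
  shows "real (card (cube_hits c x d)) \<le> x powr c / real d ^ 3"
proof -
  let ?f = "\<lambda>n::nat. nat (\<lfloor>real n powr c\<rfloor> div int d ^ 3)"
  define K where "K = nat \<lfloor>x powr c / real d ^ 3\<rfloor>"
  have fl: "\<lfloor>real n powr c\<rfloor> = int (?f n) * int d ^ 3" if "n \<in> cube_hits c x d" for n
    using that d by (auto simp: cube_hits_def pos_imp_zdiv_nonneg_iff)
  have "inj_on ?f (cube_hits c x d)"
  proof (rule linorder_inj_onI')
    fix m n assume mn: "m \<in> cube_hits c x d" "n \<in> cube_hits c x d" "m < n"
    then have "\<lfloor>real m powr c\<rfloor> < \<lfloor>real n powr c\<rfloor>"
      using c by (intro floor_powr_strict_mono) (auto simp: cube_hits_def)
    then show "?f m \<noteq> ?f n" using fl[OF mn(1)] fl[OF mn(2)] by (metis less_irrefl)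
  qed
  moreover have "?f ` cube_hits c x d \<subseteq> {1..K}"
  proof
    fix k assume "k \<in> ?f ` cube_hits c x d"
    then obtain n where n: "n \<in> cube_hits c x d" "k = ?f n" by auto
    have n1: "1 \<le> n" "real n \<le> x" using n by (auto simp: cube_hits_def)
    have "1 \<le> real n powr c" using n1 c by (intro ge_one_powr_ge_zero) auto
    then have "int k * int d ^ 3 \<ge> 1" using fl[OF n(1)] n(2) by simp
    then have k1: "k \<ge> 1" by (cases "k = 0") auto
    have "real k * real d ^ 3 = real_of_int (int k * int d ^ 3)" by simp
    also have "\<dots> = real_of_int \<lfloor>real n powr c\<rfloor>" using fl[OF n(1)] n(2) by simp
    also have "\<dots> \<le> real n powr c" by simp
    also have "\<dots> \<le> x powr c" using n1 c by (intro powr_mono2) auto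
    finally have "real k \<le> x powr c / real d ^ 3" using d by (simp add: field_simps)
    then show "k \<in> {1..K}" using k1 unfolding K_def by (auto intro: le_nat_floor)
  qed
  ultimately have "card (cube_hits c x d) \<le> card {1..K}" by (intro card_inj_on_le) auto
  then have "real (card (cube_hits c x d)) \<le> real K" by simp
  also have "\<dots> \<le> x powr c / real d ^ 3" unfolding K_def by (intro of_nat_floor) simp
  finally show ?thesis .
qed

text \<open>If \<open>n\<close> and \<open>n + a\<close> are both hits, then \<open>g n\<close> lies
  within \<open>1\<close> of some \<open>k * d ^ 3\<close>. The first factor bounds the number of
  possible \<open>k\<close>, since \<open>g\<close> is at most
  \<open>a * c * x powr (c - 1)\<close>. The second bounds the number of \<open>n\<close> for each
  \<open>k\<close>, since \<open>g\<close> grows by at least \<open>\<mu>\<close> per step.\<close>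

lemma card_cube_hits_shift:
  assumes c: "1 < c" "c < 2" and d: "d \<ge> 1" and a: "a \<ge> 1" and x: "x \<ge> 1"
  shows "real (card {n \<in> cube_hits c x d. n + a \<in> cube_hits c x d})
           \<le> (real a * c * x powr (c - 1) / real d ^ 3 + 2)
               * (2 / (c * (c - 1) * real a * x powr (c - 2)) + 1)"
proof -
  define T where "T = {n \<in> cube_hits c x d. n + a \<in> cube_hits c x d}"
  define g where "g = (\<lambda>n. (real n + real a) powr c - real n powr c)"
  define \<mu> where "\<mu> = c * (c - 1) * real a * x powr (c - 2)"
  have mu: "\<mu> > 0" using c a x unfolding \<mu>_def by auto
  define Y where "Y = real a * c * x powr (c - 1) / real d ^ 3 + 1"
  have Y: "Y \<ge> 0" unfolding Y_def using c by simp
  define K where "K = nat \<lfloor>Y\<rfloor>"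
  have T: "1 \<le> n" "real n + real a \<le> x" if "n \<in> T" for n
    using that by (auto simp: T_def cube_hits_def)
  have finT: "finite T" unfolding T_def by simp
  have "\<exists>k\<le>K. \<bar>g n - real k * real d ^ 3\<bar> \<le> 1" if n: "n \<in> T" for n
  proof -
    have dv: "int d ^ 3 dvd \<lfloor>real (n + a) powr c\<rfloor> - \<lfloor>real n powr c\<rfloor>"
      using n by (auto simp: T_def cube_hits_def intro: dvd_diff)
    have "\<lfloor>real n powr c\<rfloor> < \<lfloor>real (n + a) powr c\<rfloor>"
      by (rule floor_powr_strict_mono) (use c T[OF n] a in auto)
    \<comment> \<open>The difference of the integer parts is positive, so the multiplier is a
      natural number and only \<open>k\<close> from \<open>0\<close> to \<open>K\<close> have to be
      covered.\<close>
    then obtain k where k: "\<lfloor>real (n + a) powr c\<rfloor> - \<lfloor>real n powr c\<rfloor> = int k * int d ^ 3"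
    proof -
      assume lt: "\<lfloor>real n powr c\<rfloor> < \<lfloor>real (n + a) powr c\<rfloor>"
      obtain j where j: "\<lfloor>real (n + a) powr c\<rfloor> - \<lfloor>real n powr c\<rfloor> = int d ^ 3 * j" using dv by blast
      with lt have "int d ^ 3 * j > 0" by simp
      then have "j \<ge> 0" using d by (simp add: zero_less_mult_iff)
      then show ?thesis using j that[of "nat j"] by simp
    qed
    then have "real_of_int (\<lfloor>real (n + a) powr c\<rfloor> - \<lfloor>real n powr c\<rfloor>) = real k * real d ^ 3" by simp
    then have close: "\<bar>g n - real k * real d ^ 3\<bar> \<le> 1" unfolding g_def of_nat_add[symmetric] by linarith
    have "g n \<le> real a * c * x powr (c - 1)" unfolding g_def
      by (rule powr_diff_le) (use c a T[OF n] in auto)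
    then have "real k * real d ^ 3 \<le> real a * c * x powr (c - 1) + 1" using close by linarith
    \<comment> \<open>The rounding error \<open>1\<close> is at most \<open>d ^ 3\<close>, which
      explains the summand \<open>1\<close> in \<open>Y\<close>; counting \<open>k = 0\<close> adds
      another, giving the \<open>2\<close> in the statement.\<close>
    also have "\<dots> \<le> real a * c * x powr (c - 1) + real d ^ 3" using d by simp
    also have "\<dots> = Y * real d ^ 3" using d by (simp add: Y_def field_simps)
    finally have "real k \<le> Y" using d by simp
    then have "k \<le> K" unfolding K_def by (rule le_nat_floor)
    with close show ?thesis by blast
  qed
  then have "T \<subseteq> (\<Union>k\<in>{..K}. {n \<in> T. \<bar>g n - real k * real d ^ 3\<bar> \<le> 1})" by blast
  then have "card T \<le> card (\<Union>k\<in>{..K}. {n \<in> T. \<bar>g n - real k * real d ^ 3\<bar> \<le> 1})"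
    using finT by (intro card_mono) auto
  also have "\<dots> \<le> (\<Sum>k\<in>{..K}. card {n \<in> T. \<bar>g n - real k * real d ^ 3\<bar> \<le> 1})"
    by (rule card_UN_le) simp
  finally have "real (card T) \<le> (\<Sum>k\<in>{..K}. real (card {n \<in> T. \<bar>g n - real k * real d ^ 3\<bar> \<le> 1}))"
    unfolding of_nat_sum[symmetric] of_nat_le_iff .
  also have "\<dots> \<le> (\<Sum>k\<in>{..K}. 2 / \<mu> + 1)"
  proof (rule sum_mono)
    fix k
    show "real (card {n \<in> T. \<bar>g n - real k * real d ^ 3\<bar> \<le> 1}) \<le> 2 / \<mu> + 1"
    proof (rule card_spaced_le[where f = g and u = "real k * real d ^ 3"])
      fix m n
      assume mn: "m \<in> {n \<in> T. \<bar>g n - real k * real d ^ 3\<bar> \<le> 1}"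
        "n \<in> {n \<in> T. \<bar>g n - real k * real d ^ 3\<bar> \<le> 1}" "m < n"
      show "\<mu> * (real n - real m) \<le> g n - g m" unfolding \<mu>_def g_def
        by (rule powr_second_diff_ge) (use c a mn T[of m] T[of n] in auto)
    qed (use finT mu in auto)
  qed
  also have "\<dots> = (real K + 1) * (2 / \<mu> + 1)" by simp
  also have "\<dots> \<le> (Y + 1) * (2 / \<mu> + 1)"
    using mu Y unfolding K_def by (intro mult_right_mono add_right_mono of_nat_floor) auto
  also have "Y + 1 = real a * c * x powr (c - 1) / real d ^ 3 + 2" by (simp add: Y_def)
  finally show ?thesis unfolding T_def \<mu>_def .
qed

text \<open>The harmonic sum is at most \<open>1 + ln B\<close>. Replacing the logarithm by a small
  power lets all later estimates compare powers of \<open>x\<close> only. For \<open>B = 0\<close>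
  both sides vanish.\<close>

lemma sum_inverse_le_powr:
  assumes s: "s > 0"
  shows "(\<Sum>a\<in>{1..B}. 1 / real a) \<le> (1 + 1 / s) * real B powr s"
proof (cases "B = 0")
  case False
  then have "1 \<le> B" by simp
  then have "(\<Sum>a\<in>{1..B}. 1 / real a) \<le> 1 + ln (real B)"
  proof (induction B rule: dec_induct)
    case (step B)
    have "ln (real B / real (Suc B)) \<le> real B / real (Suc B) - 1"
      using step(1) by (intro ln_le_minus_one) simp
    moreover have "real B / real (Suc B) - 1 = - (1 / real (Suc B))" by (simp add: field_simps)
    moreover have "ln (real B / real (Suc B)) = ln (real B) - ln (real (Suc B))"
      using step(1) by (simp add: ln_div)
    moreover have "(\<Sum>a\<in>{1..Suc B}. 1 / real a) = (\<Sum>a\<in>{1..B}. 1 / real a) + 1 / real (Suc B)"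
      by simp
    ultimately show ?case using step.IH by argo
  qed simp
  also have "ln (real B) \<le> real B powr s / s" using False s by (intro ln_powr_bound) auto
  also have "1 + real B powr s / s \<le> real B powr s + real B powr s / s"
    using False s by (intro add_right_mono ge_one_powr_ge_zero) auto
  finally show ?thesis by (simp add: ring_distribs)
qed simp

text \<open>The bound for a fixed shift is multiplied out into four terms, summed over
  \<open>a \<le> B\<close>, and inserted into \<open>card_le_close_pairs\<close>; \<open>B\<close>
  stays free to balance the terms.\<close>

lemma card_cube_hits_gap:
  assumes c: "1 < c" "c < 2" and d: "d \<ge> 1" and B: "B \<ge> 1" and x: "x \<ge> 1"
  defines "\<gamma> \<equiv> 2 / (c * (c - 1))"
  shows "real (card (cube_hits c x d)) \<le>
      x / real B + 1 + (c * \<gamma> * real B * x / real d ^ 3 + c * real B ^ 2 * x powr (c - 1) / real d ^ 3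
        + 6 * \<gamma> * real B powr (1/2) * x powr (2 - c) + 2 * real B)"
proof -
  have gam: "\<gamma> > 0" unfolding \<gamma>_def using c by simp
  \<comment> \<open>The factor \<open>3\<close> is \<open>1 + 1 / s\<close> in the harmonic bound
    with \<open>s = 1/2\<close>.\<close>
  have four: "6 * \<gamma> * real B powr (1/2) * x powr (2 - c) = 2 * \<gamma> * x powr (2 - c) * (3 * real B powr (1/2))"
    by simp
  have pw: "x powr (c - 1) * x powr (2 - c) = x"
    using x by (simp add: powr_add[symmetric])
  have "real (card {n \<in> cube_hits c x d. n + a \<in> cube_hits c x d})
      \<le> c * \<gamma> * x / real d ^ 3 + c * real B * x powr (c - 1) / real d ^ 3
         + 2 * \<gamma> * x powr (2 - c) * (1 / real a) + 2" if a: "a \<in> {1..B}" for a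
  proof -
    have e1: "2 / (c * (c - 1) * real a * x powr (c - 2)) = \<gamma> * x powr (2 - c) / real a"
      using x by (simp add: \<gamma>_def powr_diff field_simps powr_numeral)
    have "real (card {n \<in> cube_hits c x d. n + a \<in> cube_hits c x d})
       \<le> (real a * c * x powr (c - 1) / real d ^ 3 + 2) * (\<gamma> * x powr (2 - c) / real a + 1)"
      using card_cube_hits_shift[OF c d _ x, of a] a unfolding e1 by simp
    also have "\<dots> = c * \<gamma> * (x powr (c - 1) * x powr (2 - c)) / real d ^ 3
        + c * real a * x powr (c - 1) / real d ^ 3 + 2 * \<gamma> * x powr (2 - c) * (1 / real a) + 2"
      using a d by (simp add: field_simps)
    also have "c * real a * x powr (c - 1) / real d ^ 3 \<le> c * real B * x powr (c - 1) / real d ^ 3"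
      using a c by (intro divide_right_mono mult_right_mono mult_left_mono) auto
    finally show ?thesis unfolding pw by simp
  qed
  then have "(\<Sum>a\<in>{1..B}. real (card {n \<in> cube_hits c x d. n + a \<in> cube_hits c x d})) \<le>
     (\<Sum>a\<in>{1..B}. c * \<gamma> * x / real d ^ 3 + c * real B * x powr (c - 1) / real d ^ 3
         + 2 * \<gamma> * x powr (2 - c) * (1 / real a) + 2)" by (rule sum_mono)
  also have "\<dots> = c * \<gamma> * real B * x / real d ^ 3 + c * real B ^ 2 * x powr (c - 1) / real d ^ 3
        + 2 * \<gamma> * x powr (2 - c) * (\<Sum>a\<in>{1..B}. 1 / real a) + 2 * real B"
    unfolding sum.distrib sum_distrib_left[symmetric] sum_constant
    by (simp add: power2_eq_square algebra_simps)
  also have "\<dots> \<le> c * \<gamma> * real B * x / real d ^ 3 + c * real B ^ 2 * x powr (c - 1) / real d ^ 3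
        + 2 * \<gamma> * x powr (2 - c) * (3 * real B powr (1/2)) + 2 * real B"
    using sum_inverse_le_powr[of "1/2" B] gam
    by (intro add_right_mono add_left_mono mult_left_mono) auto
  finally have "(\<Sum>a\<in>{1..B}. real (card {n \<in> cube_hits c x d. n + a \<in> cube_hits c x d})) \<le>
     c * \<gamma> * real B * x / real d ^ 3 + c * real B ^ 2 * x powr (c - 1) / real d ^ 3
        + 6 * \<gamma> * real B powr (1/2) * x powr (2 - c) + 2 * real B"
    unfolding four .
  moreover have "real (nat \<lfloor>x\<rfloor>) / real B \<le> x / real B"
    using x by (intro divide_right_mono of_nat_floor) auto
  moreover note card_le_close_pairs[OF cube_hits_subset B, of c x d]
  ultimately show ?thesis by (meson add_mono order_refl order_trans)
qed

text \<open>Here \<open>B\<close> is \<open>d * x powr \<kappa>\<close> rounded up, so that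
  \<open>x / B\<close> summed over \<open>d\<close> saves a power of \<open>x\<close>. The constant
  \<open>K\<close> dominates the constants of all five terms.\<close>

lemma card_cube_hits_medium:
  assumes c: "1 < c" "c < 2" and d: "d \<ge> 1" and x: "x \<ge> 1" and kap: "\<kappa> > 0"
  defines "\<gamma> \<equiv> 2 / (c * (c - 1))"
  defines "K \<equiv> 5 + 4 * c + 2 * c * \<gamma> + 12 * \<gamma>"
  shows "real (card (cube_hits c x d)) \<le> K * (x powr (1 - \<kappa>) * (1 / real d) + x powr (1 + \<kappa>) * (1 / real d ^ 2)
      + x powr (c - 1 + 2 * \<kappa>) * (1 / real d) + x powr (2 - c + \<kappa> / 2) * real d powr (1/2)
      + x powr \<kappa> * real d)"
proof -
  define z where "z = real d * x powr \<kappa>"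
  have xk: "x powr \<kappa> \<ge> 1" using x kap by (intro ge_one_powr_ge_zero) auto
  have z1: "z \<ge> 1" unfolding z_def using d xk mult_mono[of 1 "real d" 1 "x powr \<kappa>"] by simp
  define B where "B = nat \<lceil>z\<rceil>"
  have zB: "z \<le> real B" "real B \<le> 2 * z" unfolding B_def using z1 by linarith+
  have B1: "B \<ge> 1" using zB z1 by (cases "B = 0") auto
  have gam: "\<gamma> > 0" unfolding \<gamma>_def using c by simp
  have d0: "real d > 0" using d by simp
  have Kge: "5 \<le> K" "2 * c * \<gamma> \<le> K" "4 * c \<le> K" "12 * \<gamma> \<le> K" "1 \<le> K"
    unfolding K_def using c gam by auto
  have "x / real B \<le> x / z" using zB z1 x by (intro divide_left_mono) auto
  also have "\<dots> = 1 * (x powr (1 - \<kappa>) * (1 / real d))"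
    unfolding z_def using x by (simp add: powr_diff field_simps)
  also have "\<dots> \<le> K * (x powr (1 - \<kappa>) * (1 / real d))" using Kge by (intro mult_right_mono) auto
  finally have t1: "x / real B \<le> K * (x powr (1 - \<kappa>) * (1 / real d))" .
  have "c * \<gamma> * real B * x / real d ^ 3 \<le> c * \<gamma> * (2 * z) * x / real d ^ 3"
    using zB c gam x by (intro divide_right_mono mult_right_mono mult_left_mono) auto
  also have "\<dots> = 2 * c * \<gamma> * (x powr (1 + \<kappa>) * (1 / real d ^ 2))"
    unfolding z_def using d0 x by (simp add: powr_add power3_eq_cube power2_eq_square)
  also have "\<dots> \<le> K * (x powr (1 + \<kappa>) * (1 / real d ^ 2))" using Kge by (intro mult_right_mono) auto
  finally have t2: "c * \<gamma> * real B * x / real d ^ 3 \<le> K * (x powr (1 + \<kappa>) * (1 / real d ^ 2))" .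
  have "c * real B ^ 2 * x powr (c - 1) / real d ^ 3 \<le> c * (2 * z) ^ 2 * x powr (c - 1) / real d ^ 3"
    using zB c by (intro divide_right_mono mult_right_mono mult_left_mono power_mono) auto
  also have "\<dots> = 4 * c * (x powr (c - 1 + (\<kappa> + \<kappa>)) * (1 / real d))"
    unfolding z_def powr_add using d0 x by (simp add: power3_eq_cube power2_eq_square)
  also have "\<dots> \<le> K * (x powr (c - 1 + (\<kappa> + \<kappa>)) * (1 / real d))" using Kge by (intro mult_right_mono) auto
  finally have t3: "c * real B ^ 2 * x powr (c - 1) / real d ^ 3 \<le> K * (x powr (c - 1 + 2 * \<kappa>) * (1 / real d))"
    by simp
  \<comment> \<open>Weakening \<open>2 * z\<close> to \<open>4 * z\<close> makes the square root of
    the constant an integer.\<close>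
  have "6 * \<gamma> * real B powr (1/2) * x powr (2 - c) \<le> 6 * \<gamma> * (4 * z) powr (1/2) * x powr (2 - c)"
    using zB z1 gam by (intro mult_right_mono mult_left_mono powr_mono2) auto
  also have "(4 * z) powr (1/2) = 2 * (real d powr (1/2) * x powr (\<kappa> / 2))"
    unfolding z_def by (simp add: powr_mult powr_powr powr_half_sqrt)
  also have "6 * \<gamma> * (2 * (real d powr (1/2) * x powr (\<kappa> / 2))) * x powr (2 - c)
      = 12 * \<gamma> * (x powr (2 - c + \<kappa> / 2) * real d powr (1/2))"
    by (simp add: powr_add)
  also have "\<dots> \<le> K * (x powr (2 - c + \<kappa> / 2) * real d powr (1/2))" using Kge by (intro mult_right_mono) auto
  finally have t4: "6 * \<gamma> * real B powr (1/2) * x powr (2 - c)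
      \<le> K * (x powr (2 - c + \<kappa> / 2) * real d powr (1/2))" .
  have "1 + 2 * real B \<le> 5 * z" using zB z1 by linarith
  also have "\<dots> \<le> K * z" using Kge z1 by (intro mult_right_mono) auto
  finally have t5: "1 + 2 * real B \<le> K * (x powr \<kappa> * real d)" unfolding z_def by (simp add: mult_ac)
  show ?thesis
    using card_cube_hits_gap[OF c d B1 x] t1 t2 t3 t4 t5 unfolding \<gamma>_def[symmetric] distrib_left
    by linarith
qed

section \<open>Summation of the hits over all large d\<close>

lemma half_le_nat_floor:
  fixes y :: real
  assumes "y \<ge> 1"
  shows "y / 2 \<le> real (nat \<lfloor>y\<rfloor>)" "real (nat \<lfloor>y\<rfloor>) \<le> y" "1 \<le> nat \<lfloor>y\<rfloor>"
proof -
  have "1 \<le> \<lfloor>y\<rfloor>" using assms by simp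
  then have F: "real (nat \<lfloor>y\<rfloor>) = real_of_int \<lfloor>y\<rfloor>" "1 \<le> real_of_int \<lfloor>y\<rfloor>" by linarith+
  have "y < real_of_int \<lfloor>y\<rfloor> + 1" by linarith
  then have "y \<le> 2 * real_of_int \<lfloor>y\<rfloor>" using F(2) by linarith
  then show "y / 2 \<le> real (nat \<lfloor>y\<rfloor>)" unfolding F(1) by simp
  show "real (nat \<lfloor>y\<rfloor>) \<le> y" unfolding F(1) by simp
  show "1 \<le> nat \<lfloor>y\<rfloor>" using assms by (intro le_nat_floor) simp
qed

text \<open>The sum is cut at \<open>M\<close>, about \<open>x powr \<theta>\<close>:
  \<open>card_cube_hits_medium\<close> serves below the cut and the trivial bound above it. The
  hypotheses on \<kappa> push every resulting exponent down to
  \<open>1 - \<kappa> / 2\<close>.\<close>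

lemma sum_cube_hits_le:
  assumes c: "1 < c" "c < 2" and kap: "\<kappa> > 0" "2 * \<kappa> \<le> \<tau>" "12 * \<kappa> \<le> c - 1" "4 * \<kappa> \<le> 2 - c"
  obtains K where "K \<ge> 0"
    "\<And>x N. x \<ge> 1 \<Longrightarrow> (\<Sum>d\<in>{nat \<lfloor>x powr \<tau>\<rfloor><..N}. real (card (cube_hits c x d))) \<le> K * x powr (1 - \<kappa> / 2)"
proof -
  define \<gamma> where "\<gamma> = 2 / (c * (c - 1))"
  define K where "K = 5 + 4 * c + 2 * c * \<gamma> + 12 * \<gamma>"
  define L where "L = 1 + 1 / (\<kappa> / 2)"
  \<comment> \<open>With this cut the trivial bound sums to order
    \<open>x powr (c - 2 * \<theta>)\<close>, that is
    \<open>x powr (1 - 2 * \<kappa>)\<close>.\<close>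
  define \<theta> where "\<theta> = (c - 1) / 2 + \<kappa>"
  have gam: "\<gamma> > 0" unfolding \<gamma>_def using c by simp
  have K0: "K \<ge> 0" unfolding K_def using gam c by simp
  have L0: "L \<ge> 0" unfolding L_def using kap by simp
  have "(\<Sum>d\<in>{nat \<lfloor>x powr \<tau>\<rfloor><..N}. real (card (cube_hits c x d))) \<le> (K * (2 * L + 4) + 4) * x powr (1 - \<kappa> / 2)"
    if x: "x \<ge> 1" for x N
  proof -
    define D where "D = nat \<lfloor>x powr \<tau>\<rfloor>"
    define M where "M = nat \<lfloor>x powr \<theta>\<rfloor>"
    define E where "E = x powr (1 - \<kappa> / 2)"
    have mono: "x powr s \<le> E" if "s \<le> 1 - \<kappa> / 2" for s
      unfolding E_def using that x by (intro powr_mono) auto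
    have "x powr \<tau> \<ge> 1" "x powr \<theta> \<ge> 1"
      using x kap c by (auto simp: \<theta>_def intro!: ge_one_powr_ge_zero)
    note D = half_le_nat_floor[OF this(1), folded D_def] and M = half_le_nat_floor[OF this(2), folded M_def]
    have "\<theta> \<le> 1" unfolding \<theta>_def using kap(4) c by argo
    then have "x powr \<theta> \<le> x powr 1" using x by (intro powr_mono) auto
    then have Mx: "real M \<le> x" using M x by simp
    \<comment> \<open>The loss of \<open>x powr (\<kappa> / 2)\<close> is half of the saving in
      \<open>x powr (1 - \<kappa>)\<close>, whence the target exponent
      \<open>1 - \<kappa> / 2\<close>.\<close>
    have harm: "(\<Sum>d\<in>{D<..M}. 1 / real d) \<le> L * x powr (\<kappa> / 2)"
    proof -
      have "(\<Sum>d\<in>{D<..M}. 1 / real d) \<le> (\<Sum>d\<in>{1..M}. 1 / real d)"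
        by (rule sum_mono2) auto
      also have "\<dots> \<le> L * real M powr (\<kappa> / 2)"
        unfolding L_def by (rule sum_inverse_le_powr) (use kap in simp)
      also have "\<dots> \<le> L * x powr (\<kappa> / 2)"
        using L0 kap Mx by (intro mult_left_mono powr_mono2) auto
      finally show ?thesis .
    qed
    have s1: "(\<Sum>d\<in>{D<..M}. x powr (1 - \<kappa>) * (1 / real d)) \<le> L * E"
    proof -
      have "(\<Sum>d\<in>{D<..M}. x powr (1 - \<kappa>) * (1 / real d)) \<le> x powr (1 - \<kappa>) * (L * x powr (\<kappa> / 2))"
        unfolding sum_distrib_left[symmetric] by (rule mult_left_mono[OF harm]) simp
      also have "\<dots> = L * x powr (1 - \<kappa> + \<kappa> / 2)" by (simp only: powr_add mult_ac)
      also have "\<dots> \<le> L * E" by (intro mult_left_mono mono L0) auto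
      finally show ?thesis .
    qed
    have s2: "(\<Sum>d\<in>{D<..M}. x powr (1 + \<kappa>) * (1 / real d ^ 2)) \<le> 2 * E"
    proof -
      have "(\<Sum>d\<in>{D<..M}. x powr (1 + \<kappa>) * (1 / real d ^ 2)) \<le> x powr (1 + \<kappa>) * (1 / real D)"
        unfolding sum_distrib_left[symmetric]
        by (rule mult_left_mono[OF sum_inverse_squares_tail[OF D(3)]]) simp
      also have "\<dots> \<le> x powr (1 + \<kappa>) * (1 / (x powr \<tau> / 2))"
        using D x by (intro mult_left_mono divide_left_mono) auto
      also have "\<dots> = 2 * x powr (1 + \<kappa> - \<tau>)" by (simp add: powr_diff)
      also have "\<dots> \<le> 2 * E" using kap by (intro mult_left_mono mono) auto
      finally show ?thesis .
    qed
    have s3: "(\<Sum>d\<in>{D<..M}. x powr (c - 1 + 2 * \<kappa>) * (1 / real d)) \<le> L * E"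
    proof -
      have "(\<Sum>d\<in>{D<..M}. x powr (c - 1 + 2 * \<kappa>) * (1 / real d)) \<le> x powr (c - 1 + 2 * \<kappa>) * (L * x powr (\<kappa> / 2))"
        unfolding sum_distrib_left[symmetric] by (rule mult_left_mono[OF harm]) simp
      also have "\<dots> = L * x powr (c - 1 + 2 * \<kappa> + \<kappa> / 2)" by (simp only: powr_add mult_ac)
      also have "\<dots> \<le> L * E" using kap by (intro mult_left_mono mono L0) auto
      finally show ?thesis .
    qed
    have card_le: "real (card {D<..M}) \<le> x powr \<theta>" using M by simp
    have dM: "real d \<le> x powr \<theta>" if "d \<in> {D<..M}" for d
      using that M by (meson greaterThanAtMost_iff of_nat_mono order_trans)
    \<comment> \<open>The exponent reached is \<open>1 - (c - 1) / 4 + 2 * \<kappa>\<close>; this is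
      where \<kappa> must be small against \<open>c - 1\<close>.\<close>
    have s4: "(\<Sum>d\<in>{D<..M}. x powr (2 - c + \<kappa> / 2) * real d powr (1/2)) \<le> E"
    proof -
      have "(\<Sum>d\<in>{D<..M}. x powr (2 - c + \<kappa> / 2) * real d powr (1/2))
          \<le> real (card {D<..M}) * (x powr (2 - c + \<kappa> / 2) * (x powr \<theta>) powr (1/2))"
        using dM by (intro sum_bounded_above mult_left_mono powr_mono2) auto
      also have "\<dots> \<le> x powr \<theta> * (x powr (2 - c + \<kappa> / 2) * (x powr \<theta>) powr (1/2))"
        by (rule mult_right_mono[OF card_le]) simp
      also have "\<dots> = x powr (\<theta> + (2 - c + \<kappa> / 2 + \<theta> / 2))"
        by (simp only: powr_add powr_powr mult_1_right times_divide_eq_right)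
      also have "\<dots> \<le> E" using kap by (intro mono) (simp add: \<theta>_def field_simps)
      finally show ?thesis .
    qed
    have s5: "(\<Sum>d\<in>{D<..M}. x powr \<kappa> * real d) \<le> E"
    proof -
      have "(\<Sum>d\<in>{D<..M}. x powr \<kappa> * real d) \<le> real (card {D<..M}) * (x powr \<kappa> * x powr \<theta>)"
        using dM by (intro sum_bounded_above mult_left_mono) auto
      also have "\<dots> \<le> x powr \<theta> * (x powr \<kappa> * x powr \<theta>)"
        by (rule mult_right_mono[OF card_le]) simp
      also have "\<dots> = x powr (\<theta> + (\<kappa> + \<theta>))" by (simp only: powr_add)
      also have "\<dots> \<le> E" using kap by (intro mono) (simp add: \<theta>_def field_simps)
      finally show ?thesis .
    qed
    have "(\<Sum>d\<in>{D<..M}. real (card (cube_hits c x d))) \<le>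
      (\<Sum>d\<in>{D<..M}. K * (x powr (1 - \<kappa>) * (1 / real d) + x powr (1 + \<kappa>) * (1 / real d ^ 2)
      + x powr (c - 1 + 2 * \<kappa>) * (1 / real d) + x powr (2 - c + \<kappa> / 2) * real d powr (1/2)
      + x powr \<kappa> * real d))"
      unfolding K_def \<gamma>_def by (intro sum_mono card_cube_hits_medium) (use c x kap in auto)
    also have "\<dots> \<le> K * (L * E + 2 * E + L * E + E + E)"
      unfolding sum_distrib_left[symmetric] sum.distrib
      by (intro mult_left_mono add_mono s1[folded sum_distrib_left] s2[folded sum_distrib_left]
            s3[folded sum_distrib_left] s4[folded sum_distrib_left] s5[folded sum_distrib_left] K0)
    also have "\<dots> = K * (2 * L + 4) * E" by (simp add: algebra_simps)
    finally have medium: "(\<Sum>d\<in>{D<..M}. real (card (cube_hits c x d))) \<le> K * (2 * L + 4) * E" .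
    have "(\<Sum>d\<in>{M<..N}. real (card (cube_hits c x d))) \<le> (\<Sum>d\<in>{M<..N}. x powr c * (1 / real d ^ 3))"
    proof (rule sum_mono)
      fix d assume "d \<in> {M<..N}"
      then show "real (card (cube_hits c x d)) \<le> x powr c * (1 / real d ^ 3)"
        using card_cube_hits_trivial[OF c(1) _ x, of d] by simp
    qed
    also have "\<dots> \<le> x powr c * (1 / real M ^ 2)"
      unfolding sum_distrib_left[symmetric]
      by (rule mult_left_mono[OF sum_inverse_cubes_tail[OF M(3)]]) simp
    also have "\<dots> \<le> x powr c * (1 / (x powr \<theta> / 2) ^ 2)"
      using M x by (intro mult_left_mono divide_left_mono power_mono) auto
    also have "\<dots> = 4 * x powr (c - (\<theta> + \<theta>))"
      unfolding powr_diff powr_add by (simp add: power2_eq_square)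
    also have "\<dots> \<le> 4 * E" using kap by (intro mult_left_mono mono) (auto simp: \<theta>_def field_simps)
    finally have large: "(\<Sum>d\<in>{M<..N}. real (card (cube_hits c x d))) \<le> 4 * E" .
    \<comment> \<open>Only an inclusion of index sets is used, which holds in whatever order
      \<open>D\<close>, \<open>M\<close> and \<open>N\<close> stand.\<close>
    have "(\<Sum>d\<in>{D<..N}. real (card (cube_hits c x d))) \<le> (\<Sum>d\<in>{D<..M} \<union> {M<..N}. real (card (cube_hits c x d)))"
      by (rule sum_mono2) auto
    also have "\<dots> = (\<Sum>d\<in>{D<..M}. real (card (cube_hits c x d))) + (\<Sum>d\<in>{M<..N}. real (card (cube_hits c x d)))"
      by (rule sum.union_disjoint) auto
    also have "\<dots> \<le> K * (2 * L + 4) * E + 4 * E" using medium large by (rule add_mono)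
    also have "\<dots> = (K * (2 * L + 4) + 4) * E" by (simp add: ring_distribs)
    finally show ?thesis unfolding D_def E_def .
  qed
  then show ?thesis using that[of "K * (2 * L + 4) + 4"] K0 L0 by auto
qed

subsection \<open>The sieve\<close>

text \<open>Detect divisibility by averaging the characters \<open>h / q\<close>. The frequency
  \<open>h = 0\<close> gives the main term \<open>card S / q\<close>, and each of the fewer than
  \<open>q\<close> others contributes at most \<open>E / q\<close>.\<close>

lemma card_dvd_equidistributed:
  fixes S :: "nat set" and f :: "nat \<Rightarrow> int"
  assumes fin: "finite S" and q: "q > 0" and E: "E \<ge> 0"
    and bound: "\<And>a r :: int. coprime a r \<Longrightarrow> 2 \<le> r \<Longrightarrow> r \<le> int q \<Longrightarrow>
        norm (\<Sum>n\<in>S. e (real_of_int a / real_of_int r * real_of_int (f n))) \<le> E"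
  shows "\<bar>real (card {n \<in> S. int q dvd f n}) - real (card S) / real q\<bar> \<le> E"
proof -
  let ?F = "card {n \<in> S. int q dvd f n}"
  define W where "W = (\<lambda>h::nat. \<Sum>n\<in>S. e (real h / real q * real_of_int (f n)))"
  have "(\<Sum>h<q. W h) = (\<Sum>n\<in>S. \<Sum>h<q. e (real h / real q * real_of_int (f n)))"
    unfolding W_def by (rule sum.swap)
  also have "\<dots> = (\<Sum>n\<in>S. if int q dvd f n then of_nat q else 0)"
    by (simp only: sum_e_div[OF q])
  also have "\<dots> = of_nat q * of_nat ?F"
    using fin by (simp add: sum.If_cases Int_def)
  finally have total: "(\<Sum>h<q. W h) = of_nat q * of_nat ?F" .
  have "{..<q} = insert 0 {1..<q}" using q by auto
  then have "(\<Sum>h<q. W h) = W 0 + (\<Sum>h\<in>{1..<q}. W h)" by simp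
  moreover have "W 0 = of_nat (card S)" by (simp add: W_def e_def)
  ultimately have split: "of_nat q * of_nat ?F - of_nat (card S) = (\<Sum>h\<in>{1..<q}. W h)"
    using total by (simp add: algebra_simps)
  have Wh: "norm (W h) \<le> E" if h: "h \<in> {1..<q}" for h
  proof -
    \<comment> \<open>In lowest terms \<open>h / q\<close> is \<open>a / r\<close> with
      \<open>0 < a < r\<close>, so \<open>r \<ge> 2\<close> and the hypothesis applies.\<close>
    define g where "g = gcd h q"
    obtain a r where ar: "h = a * g" "q = r * g" "coprime a r"
      unfolding g_def using gcd_coprime_exists[of h q] q by auto
    have g0: "g > 0" unfolding g_def using q by simp
    have "a < r" using h ar g0 by auto
    moreover have "a > 0" using h ar by (cases a) auto
    ultimately have "2 \<le> int r" by simp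
    moreover have "int r \<le> int q" using ar(2) g0 by (cases g) auto
    moreover have "coprime (int a) (int r)" using ar(3) by simp
    ultimately have "norm (\<Sum>n\<in>S. e (real_of_int (int a) / real_of_int (int r) * real_of_int (f n))) \<le> E"
      by (intro bound)
    moreover have "real h / real q = real_of_int (int a) / real_of_int (int r)"
      using ar(1,2) g0 by simp
    ultimately show ?thesis unfolding W_def by simp
  qed
  have "of_real (real q * real ?F - real (card S)) = (\<Sum>h\<in>{1..<q}. W h)"
    using split by simp
  then have "\<bar>real q * real ?F - real (card S)\<bar> = norm (\<Sum>h\<in>{1..<q}. W h)"
    by (metis norm_of_real)
  also have "\<dots> \<le> real (card {1..<q}) * E"
    by (rule order_trans[OF norm_sum sum_bounded_above]) (use Wh in auto)
  also have "\<dots> \<le> real q * E" using E by (intro mult_right_mono) auto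
  finally have "\<bar>real q * real ?F - real (card S)\<bar> \<le> real q * E" .
  moreover have "real q * real ?F - real (card S) = real q * (real ?F - real (card S) / real q)"
    using q by (simp add: right_diff_distrib)
  then have "\<bar>real q * real ?F - real (card S)\<bar> = real q * \<bar>real ?F - real (card S) / real q\<bar>"
    by (simp add: abs_mult)
  ultimately show ?thesis using q by simp
qed

text \<open>The three error terms come from the equidistribution error for each
  \<open>d \<le> D\<close>, from completing the Moebius series (with \<open>card S \<le> x\<close>),
  and from all \<open>d > D\<close>.\<close>

lemma cube_free_count_error:
  assumes c: "1 < c" and x: "x \<ge> 1" and D: "D \<ge> 1"
    and S: "S \<subseteq> {n. 1 \<le> n \<and> real n \<le> x}"
    and equi: "\<And>d. d \<in> {1..D} \<Longrightarrow>
       \<bar>real (card {n \<in> S. int d ^ 3 dvd \<lfloor>real n powr c\<rfloor>}) - real (card S) / real d ^ 3\<bar> \<le> E"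
  shows "\<bar>real (card {n \<in> S. cube_free (nat \<lfloor>real n powr c\<rfloor>)}) - real (card S) / zeta3\<bar>
      \<le> real D * E + x / real D ^ 2
          + (\<Sum>d\<in>{D<..nat \<lfloor>x powr c\<rfloor>}. real (card (cube_hits c x d)))"
proof -
  define N where "N = nat \<lfloor>x powr c\<rfloor>"
  define m where "m = (\<lambda>n::nat. nat \<lfloor>real n powr c\<rfloor>)"
  define F where "F = (\<lambda>d::nat. {n \<in> S. int d ^ 3 dvd \<lfloor>real n powr c\<rfloor>})"
  have Sx: "S \<subseteq> {1..nat \<lfloor>x\<rfloor>}" using S by (auto simp: le_nat_floor)
  then have finS: "finite S" using finite_subset by blast
  have cardS: "real (card S) \<le> x"
  proof -
    have "card S \<le> card {1..nat \<lfloor>x\<rfloor>}" by (rule card_mono[OF _ Sx]) simp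
    then have "real (card S) \<le> real (nat \<lfloor>x\<rfloor>)" by simp
    also have "\<dots> \<le> x" using x by (intro of_nat_floor) simp
    finally show ?thesis .
  qed
  have m: "m n > 0" "m n \<le> N" if "n \<in> S" for n
  proof -
    have n: "1 \<le> n" "real n \<le> x" using that S by auto
    have "1 \<le> real n powr c" using n c by (intro ge_one_powr_ge_zero) auto
    then show "m n > 0" unfolding m_def by simp
    have "real n powr c \<le> x powr c" using n c by (intro powr_mono2) auto
    then show "m n \<le> N" unfolding m_def N_def by (intro nat_mono floor_mono)
  qed
  have dvd_iff: "int d ^ 3 dvd \<lfloor>real n powr c\<rfloor> \<longleftrightarrow> d ^ 3 dvd m n" if "n \<in> S" for d n
  proof -
    have "\<lfloor>real n powr c\<rfloor> = int (m n)" unfolding m_def by simp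
    then show ?thesis by (metis int_dvd_int_iff of_nat_power)
  qed
  have ind: "(if cube_free (m n) then 1 else 0) = (\<Sum>d\<in>{1..N}. if d ^ 3 dvd m n then mu d else 0)"
    if n: "n \<in> S" for n
  proof -
    have "{d. d ^ 3 dvd m n} = {d \<in> {1..N}. d ^ 3 dvd m n}"
    proof -
      have "1 \<le> d \<and> d \<le> N" if d: "d ^ 3 dvd m n" for d
      proof
        show "1 \<le> d" using d m[OF n] by (cases "d = 0") auto
        have "d dvd m n" using d by (meson dvd_power dvd_trans zero_less_numeral)
        then show "d \<le> N" using m[OF n] dvd_imp_le order_trans by blast
      qed
      then show ?thesis by auto
    qed
    then have "(\<Sum>d | d ^ 3 dvd m n. mu d) = (\<Sum>d\<in>{1..N}. if d ^ 3 dvd m n then mu d else 0)"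
      by (simp only: sum.inter_filter[OF finite_atLeastAtMost])
    then show ?thesis using sum_mu_cube_dvd[OF m(1)[OF n]] by simp
  qed
  have "real (card {n \<in> S. cube_free (m n)}) = (\<Sum>n\<in>S. if cube_free (m n) then 1 else 0)"
    using finS by (simp add: sum.If_cases Int_def)
  also have "\<dots> = (\<Sum>n\<in>S. \<Sum>d\<in>{1..N}. if d ^ 3 dvd m n then mu d else 0)"
    by (rule sum.cong) (use ind in auto)
  also have "\<dots> = (\<Sum>d\<in>{1..N}. \<Sum>n\<in>S. if d ^ 3 dvd m n then mu d else 0)"
    by (rule sum.swap)
  also have "\<dots> = (\<Sum>d\<in>{1..N}. mu d * real (card (F d)))"
  proof (rule sum.cong)
    fix d
    have "F d = {n \<in> S. d ^ 3 dvd m n}" unfolding F_def using dvd_iff by auto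
    then show "(\<Sum>n\<in>S. if d ^ 3 dvd m n then mu d else 0) = mu d * real (card (F d))"
      using finS by (simp add: sum.If_cases Int_def)
  qed simp
  finally have T: "real (card {n \<in> S. cube_free (m n)}) = (\<Sum>d\<in>{1..N}. mu d * real (card (F d)))" .
  \<comment> \<open>Needed because \<open>D\<close> may exceed \<open>N\<close>: the terms added to
    reach \<open>D\<close> are zero.\<close>
  have Fz: "card (F d) = 0" if "d > N" for d
  proof -
    have "\<not> d ^ 3 dvd m n" if n: "n \<in> S" for n
    proof
      assume "d ^ 3 dvd m n"
      then have "d dvd m n" by (meson dvd_power dvd_trans zero_less_numeral)
      then show False using dvd_imp_le[OF _ m(1)[OF n]] m(2)[OF n] \<open>d > N\<close> by fastforce
    qed
    then have "F d = {}" unfolding F_def using dvd_iff by blast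
    then show ?thesis by simp
  qed
  have "(\<Sum>d\<in>{1..N}. mu d * real (card (F d))) = (\<Sum>d\<in>{1..D} \<union> {D<..N}. mu d * real (card (F d)))"
    by (rule sum.mono_neutral_left) (use Fz in auto)
  also have "\<dots> = (\<Sum>d\<in>{1..D}. mu d * real (card (F d))) + (\<Sum>d\<in>{D<..N}. mu d * real (card (F d)))"
    by (rule sum.union_disjoint) auto
  finally have T2: "real (card {n \<in> S. cube_free (m n)})
      = (\<Sum>d\<in>{1..D}. mu d * real (card (F d))) + (\<Sum>d\<in>{D<..N}. mu d * real (card (F d)))"
    using T by simp
  \<comment> \<open>For large \<open>d\<close>, \<open>S\<close> is enlarged to all
    \<open>n \<le> x\<close>, where the elementary bounds apply.\<close>
  have e1: "\<bar>\<Sum>d\<in>{D<..N}. mu d * real (card (F d))\<bar> \<le> (\<Sum>d\<in>{D<..N}. real (card (cube_hits c x d)))"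
  proof (rule order_trans[OF sum_abs sum_mono])
    fix d
    have "card (F d) \<le> card (cube_hits c x d)"
      using S by (intro card_mono finite_cube_hits) (auto simp: F_def cube_hits_def)
    then have "\<bar>mu d\<bar> * real (card (F d)) \<le> 1 * real (card (cube_hits c x d))"
      by (intro mult_mono abs_mu_le_1) auto
    then show "\<bar>mu d * real (card (F d))\<bar> \<le> real (card (cube_hits c x d))" by (simp add: abs_mult)
  qed
  have e2: "\<bar>(\<Sum>d\<in>{1..D}. mu d * real (card (F d))) - real (card S) * (\<Sum>d\<in>{1..D}. mu d / real d ^ 3)\<bar> \<le> real D * E"
  proof -
    have "(\<Sum>d\<in>{1..D}. mu d * real (card (F d))) - real (card S) * (\<Sum>d\<in>{1..D}. mu d / real d ^ 3)
        = (\<Sum>d\<in>{1..D}. mu d * (real (card (F d)) - real (card S) / real d ^ 3))"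
      unfolding sum_distrib_left sum_subtractf[symmetric] by (rule sum.cong) (auto simp: algebra_simps)
    also have "\<bar>\<dots>\<bar> \<le> real (card {1..D}) * E"
    proof (rule order_trans[OF sum_abs sum_bounded_above])
      fix d assume d: "d \<in> {1..D}"
      have "\<bar>mu d\<bar> * \<bar>real (card (F d)) - real (card S) / real d ^ 3\<bar> \<le> 1 * E"
        using equi[OF d] unfolding F_def by (intro mult_mono abs_mu_le_1) auto
      then show "\<bar>mu d * (real (card (F d)) - real (card S) / real d ^ 3)\<bar> \<le> E" by (simp add: abs_mult)
    qed
    finally show ?thesis by simp
  qed
  have e3: "\<bar>real (card S) * (\<Sum>d\<in>{1..D}. mu d / real d ^ 3) - real (card S) / zeta3\<bar> \<le> x / real D ^ 2"
  proof -
    have "real (card S) * (\<Sum>d\<in>{1..D}. mu d / real d ^ 3) - real (card S) / zeta3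
        = real (card S) * ((\<Sum>d\<in>{1..D}. mu d / real d ^ 3) - 1 / zeta3)"
      by (simp add: right_diff_distrib)
    also have "\<bar>\<dots>\<bar> = real (card S) * \<bar>(\<Sum>d\<in>{1..D}. mu d / real d ^ 3) - 1 / zeta3\<bar>"
      by (simp add: abs_mult)
    also have "\<dots> \<le> x * (1 / real D ^ 2)"
      using x by (intro mult_mono cardS mu_cube_partial_sum D) auto
    finally show ?thesis by simp
  qed
  show ?thesis using T2 e1 e2 e3 unfolding m_def N_def by linarith
qed

section \<open>Choice of the exponents and assembly of the error terms\<close>

theorem theorem1:
  fixes c :: real and A :: "nat set"
  assumes "1 < c" and "c < 11/6"
    and "cond_C1 A" and "cond_C2 c A"
  shows "\<exists>\<epsilon>0>0. \<forall>\<epsilon>. 0 < \<epsilon> \<and> \<epsilon> < \<epsilon>0 \<and> \<epsilon> < 10 powr (-10) \<longrightarrow>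
    (\<lambda>x::real. real (card {n \<in> A. 1 \<le> n \<and> real n \<le> x \<and> cube_free (nat \<lfloor>real n powr c\<rfloor>)})
        - real (count_A A x) / zeta3)
      \<in> O[at_top](\<lambda>x. x powr (1 - \<epsilon>))"
proof -
  have c: "1 < c" "c < 2" using assms by auto
  obtain \<eta>0 where eta0: "\<eta>0 > 0" and C2: "\<And>\<eta>. 0 < \<eta> \<Longrightarrow> \<eta> < \<eta>0 \<Longrightarrow>
     \<exists>\<delta> C. \<eta> \<le> \<delta> \<and> \<delta> < 1/2 \<and> C > 0 \<and>
       (\<forall>x::real. \<forall>a q::int. x > 1 \<and> coprime a q \<and> 2 \<le> q \<and> real_of_int q \<le> x powr \<eta> \<longrightarrow>
          norm (\<Sum>n\<in>{n \<in> A. 1 \<le> n \<and> real n \<le> x}.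
                   e (real_of_int a / real_of_int q * real_of_int \<lfloor>real n powr c\<rfloor>))
            \<le> C * x powr (1 - \<delta>))"
    using assms(4) unfolding cond_C2_def by blast
  define \<eta> where "\<eta> = \<eta>0 / 2"
  have eta: "0 < \<eta>" "\<eta> < \<eta>0" using eta0 by (auto simp: \<eta>_def)
  obtain \<delta> C where dC: "\<eta> \<le> \<delta>" "C > 0" and
    bound: "\<And>x a q. x > 1 \<Longrightarrow> coprime a q \<Longrightarrow> 2 \<le> q \<Longrightarrow> real_of_int q \<le> x powr \<eta> \<Longrightarrow>
          norm (\<Sum>n\<in>{n \<in> A. 1 \<le> n \<and> real n \<le> x}.
                   e (real_of_int a / real_of_int q * real_of_int \<lfloor>real n powr c\<rfloor>))
            \<le> C * x powr (1 - \<delta>)"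
    using C2[OF eta] by blast
  \<comment> \<open>For \<open>d \<le> x powr \<tau>\<close> the modulus \<open>d ^ 3\<close>, and
    with it every reduced denominator, stays within the range \<open>x powr \<eta>\<close> of
    (C2).\<close>
  define \<tau> where "\<tau> = \<eta> / 3"
  define \<kappa> where "\<kappa> = min (\<tau> / 2) (min ((c - 1) / 12) ((2 - c) / 4))"
  have kap: "\<kappa> > 0" "2 * \<kappa> \<le> \<tau>" "12 * \<kappa> \<le> c - 1" "4 * \<kappa> \<le> 2 - c"
    using c eta unfolding \<kappa>_def \<tau>_def by (auto simp: min_def)
  obtain K where K: "K \<ge> 0"
    "\<And>x N. x \<ge> 1 \<Longrightarrow> (\<Sum>d\<in>{nat \<lfloor>x powr \<tau>\<rfloor><..N}. real (card (cube_hits c x d))) \<le> K * x powr (1 - \<kappa> / 2)"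
    using sum_cube_hits_le[OF c kap] by blast
  define R where "R = (\<lambda>x::real. real (card {n \<in> A. 1 \<le> n \<and> real n \<le> x \<and> cube_free (nat \<lfloor>real n powr c\<rfloor>)})
        - real (count_A A x) / zeta3)"
  have R: "\<bar>R x\<bar> \<le> (C + 4 + K) * x powr (1 - \<kappa> / 2)" if x: "x > 1" for x
  proof -
    define S where "S = {n \<in> A. 1 \<le> n \<and> real n \<le> x}"
    define D where "D = nat \<lfloor>x powr \<tau>\<rfloor>"
    define E where "E = x powr (1 - \<kappa> / 2)"
    have mono: "x powr s \<le> E" if "s \<le> 1 - \<kappa> / 2" for s
      unfolding E_def using that x by (intro powr_mono) auto
    have tau0: "0 < \<tau>" using eta by (simp add: \<tau>_def)
    have "x powr \<tau> \<ge> 1" using x tau0 by (intro ge_one_powr_ge_zero) auto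
    note D = half_le_nat_floor[OF this, folded D_def]
    have finS: "finite S"
      by (rule finite_subset[of _ "{1..nat \<lfloor>x\<rfloor>}"]) (auto simp: S_def le_nat_floor)
    have "\<bar>real (card {n \<in> S. int d ^ 3 dvd \<lfloor>real n powr c\<rfloor>}) - real (card S) / real d ^ 3\<bar>
        \<le> C * x powr (1 - \<delta>)" if d: "d \<in> {1..D}" for d
    proof -
      have "real d \<le> x powr \<tau>" using d D(2) by (meson atLeastAtMost_iff of_nat_mono order_trans)
      then have "real d ^ 3 \<le> (x powr \<tau>) ^ 3" by (intro power_mono) auto
      also have "\<dots> = x powr \<eta>" using x by (simp add: \<tau>_def powr_power)
      finally have d3: "real (d ^ 3) \<le> x powr \<eta>" by simp
      have "\<bar>real (card {n \<in> S. int (d ^ 3) dvd \<lfloor>real n powr c\<rfloor>}) - real (card S) / real (d ^ 3)\<bar>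
        \<le> C * x powr (1 - \<delta>)"
      proof (rule card_dvd_equidistributed[OF finS])
        fix a r :: int
        assume r: "coprime a r" "2 \<le> r" "r \<le> int (d ^ 3)"
        have "real_of_int r \<le> x powr \<eta>" using r(3) d3 by linarith
        then show "norm (\<Sum>n\<in>S. e (real_of_int a / real_of_int r * real_of_int \<lfloor>real n powr c\<rfloor>))
            \<le> C * x powr (1 - \<delta>)" unfolding S_def using bound[OF x r(1,2)] by simp
      qed (use d dC in auto)
      then show ?thesis by simp
    qed
    then have "\<bar>real (card {n \<in> S. cube_free (nat \<lfloor>real n powr c\<rfloor>)}) - real (card S) / zeta3\<bar>
      \<le> real D * (C * x powr (1 - \<delta>)) + x / real D ^ 2
          + (\<Sum>d\<in>{D<..nat \<lfloor>x powr c\<rfloor>}. real (card (cube_hits c x d)))"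
      by (intro cube_free_count_error c D) (use x in \<open>auto simp: S_def\<close>)
    moreover have "R x = real (card {n \<in> S. cube_free (nat \<lfloor>real n powr c\<rfloor>)}) - real (card S) / zeta3"
      unfolding R_def S_def count_A_def by (simp add: conj_ac)
    \<comment> \<open>Since \<delta> \<ge> \<eta> = 3\<tau>, the saving from (C2) outweighs the
      number \<open>D \<le> x powr \<tau>\<close> of moduli.\<close>
    moreover have "real D * (C * x powr (1 - \<delta>)) \<le> C * E"
    proof -
      have "real D * (C * x powr (1 - \<delta>)) \<le> x powr \<tau> * (C * x powr (1 - \<delta>))"
        using D dC by (intro mult_right_mono) auto
      also have "\<dots> = C * x powr (\<tau> + (1 - \<delta>))" by (simp only: powr_add mult_ac)
      also have "\<dots> \<le> C * E" using dC kap tau0 by (intro mult_left_mono mono) (auto simp: \<tau>_def)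
      finally show ?thesis .
    qed
    moreover have "x / real D ^ 2 \<le> 4 * E"
    proof -
      have "x / real D ^ 2 \<le> x / (x powr \<tau> / 2) ^ 2"
        using D x by (intro divide_left_mono power_mono) auto
      also have "\<dots> = 4 * x powr (1 - (\<tau> + \<tau>))"
        unfolding powr_diff powr_add using x by (simp add: power2_eq_square)
      also have "\<dots> \<le> 4 * E" using kap by (intro mult_left_mono mono) auto
      finally show ?thesis .
    qed
    moreover have "(\<Sum>d\<in>{D<..nat \<lfloor>x powr c\<rfloor>}. real (card (cube_hits c x d))) \<le> K * E"
      unfolding D_def E_def using x by (intro K) simp
    ultimately have "\<bar>R x\<bar> \<le> C * E + 4 * E + K * E" by linarith
    then show ?thesis unfolding E_def by (simp add: ring_distribs)
  qed
  \<comment> \<open>All errors are of order \<open>x powr (1 - \<kappa> / 2)\<close>, so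
    \<open>\<kappa> / 2\<close> is the witness for \<open>\<epsilon>0\<close>.\<close>
  have "R \<in> O[at_top](\<lambda>x. x powr (1 - \<epsilon>))" if eps: "\<epsilon> < \<kappa> / 2" for \<epsilon>
  proof (rule bigoI)
    show "\<forall>\<^sub>F x in at_top. norm (R x) \<le> (C + 4 + K) * norm (x powr (1 - \<epsilon>))"
      using eventually_gt_at_top[of 1]
    proof eventually_elim
      case (elim x)
      have "\<bar>R x\<bar> \<le> (C + 4 + K) * x powr (1 - \<kappa> / 2)" by (rule R[OF elim])
      also have "\<dots> \<le> (C + 4 + K) * x powr (1 - \<epsilon>)"
        using dC K elim eps by (intro mult_left_mono powr_mono) auto
      finally show ?case by simp
    qed
  qed
  then show ?thesis unfolding R_def using kap(1) by (intro exI[of _ "\<kappa> / 2"]) auto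
qed

end
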